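(* Let $k>1$ be an integer, let the parameters $(p,\lambda)$ lie in $[0,1]\times[0,\infty)$, and let $X_{ij}$ ($1\le i\le k$, $j\ge1$) be mutually independent random variables with $X_{ij}\sim\mathrm{Poisson}(p(1-p)^{i-1}\lambda t)$. For $n\ge1$ put $$s_n=\frac1n\sum_{j=1}^n\sum_{i=1}^kX_{ij},\qquad z_n=\frac1n\sum_{j=1}^n\sum_{i=1}^k(i-1)X_{ij},$$ $$a_n=-s_n-z_n+ks_n,\quad b_n=-z_n+ks_n,\quad c_n=z_n+s_n,\quad d_n=z_n,$$ and let $A_n$ be the event that the equation $$a_ny^{k+1}-b_ny^k+c_ny-d_n=0$$ has exactly one root $y$ in $(0,1)$. Then $A_n$ happens for all sufficiently large $n$ almost surely.
   Context: Here $X_{ij}$ is the number of neutrons detected at layer $i$ of a $k$-layer detector in the $j$-th independent experiment, over the time interval $[0,t]$; $p$ is the absorption probability at each layer, and $\lambda$ is the intensity of the incoming Poisson process. The equation is the one satisfied by $y=1-\hat p_n$, with $(\hat p_n,\hat\lambda_n)$ the maximum likelihood estimator of $(p,\lambda)$; it is obtained from the score equations under the assumption that $\hat p_n(1-\hat p_n)\ne0$ and $\hat\lambda_n\ne0$.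
   Formalization: Assumes in addition 0 < p < 1, λ > 0 and t > 0: if p = 0, λ = 0 or t = 0 all counts vanish a.s. and every y is a root; if p = 1 then z_n = 0 a.s. and the equation has no root in (0,1), or all y are roots, so the claim fails there. *)

theory Defs
  imports "HOL-Probability.Probability"
begin

text \<open>
  \<open>X i j \<omega>\<close> is the number of neutrons detected at layer \<open>i\<close> in the \<open>j\<close>-th experiment; layers and
  experiments are both numbered from 1.
\<close>

definition s_stat :: "(nat \<Rightarrow> nat \<Rightarrow> 'a \<Rightarrow> nat) \<Rightarrow> nat \<Rightarrow> nat \<Rightarrow> 'a \<Rightarrow> real" where
  "s_stat X k n \<omega> = 1 / real n * (\<Sum>j=1..n. \<Sum>i=1..k. real (X i j \<omega>))"

definition z_stat :: "(nat \<Rightarrow> nat \<Rightarrow> 'a \<Rightarrow> nat) \<Rightarrow> nat \<Rightarrow> nat \<Rightarrow> 'a \<Rightarrow> real" where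
  "z_stat X k n \<omega> = 1 / real n * (\<Sum>j=1..n. \<Sum>i=1..k. (real i - 1) * real (X i j \<omega>))"

definition a_coef :: "(nat \<Rightarrow> nat \<Rightarrow> 'a \<Rightarrow> nat) \<Rightarrow> nat \<Rightarrow> nat \<Rightarrow> 'a \<Rightarrow> real" where
  "a_coef X k n \<omega> = - s_stat X k n \<omega> - z_stat X k n \<omega> + real k * s_stat X k n \<omega>"

definition b_coef :: "(nat \<Rightarrow> nat \<Rightarrow> 'a \<Rightarrow> nat) \<Rightarrow> nat \<Rightarrow> nat \<Rightarrow> 'a \<Rightarrow> real" where
  "b_coef X k n \<omega> = - z_stat X k n \<omega> + real k * s_stat X k n \<omega>"

definition c_coef :: "(nat \<Rightarrow> nat \<Rightarrow> 'a \<Rightarrow> nat) \<Rightarrow> nat \<Rightarrow> nat \<Rightarrow> 'a \<Rightarrow> real" where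
  "c_coef X k n \<omega> = z_stat X k n \<omega> + s_stat X k n \<omega>"

definition d_coef :: "(nat \<Rightarrow> nat \<Rightarrow> 'a \<Rightarrow> nat) \<Rightarrow> nat \<Rightarrow> nat \<Rightarrow> 'a \<Rightarrow> real" where
  "d_coef X k n \<omega> = z_stat X k n \<omega>"

text \<open>
  The roots are counted without multiplicity. The polynomial vanishes identically if all counts
  are zero, and then the outcome is not in the event.
\<close>

definition unique_root_event ::
  "'a measure \<Rightarrow> (nat \<Rightarrow> nat \<Rightarrow> 'a \<Rightarrow> nat) \<Rightarrow> nat \<Rightarrow> nat \<Rightarrow> 'a set" where
  "unique_root_event M X k n = {\<omega> \<in> space M. \<exists>!y::real. y \<in> {0<..<1} \<and>
     a_coef X k n \<omega> * y ^ (k + 1) - b_coef X k n \<omega> * y ^ k + c_coef X k n \<omega> * y - d_coef X k n \<omega> = 0}"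

end

theory Submission
  imports Defs
begin

text \<open>
  The score polynomial is \<open>(1 - y)\<^sup>2 * (\<Sum>m<k. (s * m - z) * y ^ m)\<close>. The coefficients of the
  second factor change sign once, so it has exactly one root in \<open>(0, 1)\<close> when
  \<open>0 < 2 * z < (k - 1) * s\<close>. No law of large numbers is needed for this: both inequalities fail
  with exponentially small probability, by a Chernoff bound.
\<close>

section \<open>Algebra of the score polynomial and uniqueness of its root\<close>

lemma score_polynomial_factor:
  fixes s z y :: real
  shows "(- s - z + real k * s) * y ^ (k + 1) - (- z + real k * s) * y ^ k + (z + s) * y - z
    = (1 - y)\<^sup>2 * (\<Sum>m<k. (s * real m - z) * y ^ m)"
proof (induction k)
  case (Suc k)
  have "(1 - y)\<^sup>2 * (\<Sum>m<Suc k. (s * real m - z) * y ^ m)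
      = (1 - y)\<^sup>2 * (\<Sum>m<k. (s * real m - z) * y ^ m) + (1 - y)\<^sup>2 * ((s * real k - z) * y ^ k)"
    by (simp add: algebra_simps)
  then show ?case
    unfolding Suc.IH[symmetric] by (simp add: algebra_simps power2_eq_square)
qed (simp add: algebra_simps)

text \<open>After division by \<open>y powr (z / s)\<close> each summand is increasing in \<open>y\<close>.\<close>

lemma linear_coeff_sum_pos_beyond_root:
  fixes s z x y :: real
  assumes "s > 0" "z > 0" "k > 0" "0 < x" "x < y"
    and root: "(\<Sum>m<k. (s * real m - z) * x ^ m) = 0"
  shows "(\<Sum>m<k. (s * real m - z) * y ^ m) > 0"
proof -
  define u where "u = y / x"
  have u: "u > 1" and y: "y = u * x" using assms by (auto simp: u_def field_simps)
  \<comment> \<open>\<open>w m\<close> is the summand at \<open>y\<close> minus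
    \<open>u powr (z / s)\<close> times the summand at \<open>x\<close>. The factors
    \<open>s * real m - z\<close> and \<open>u ^ m - u powr (z / s)\<close> both change sign at
    \<open>m = z / s\<close>, so their product is nonnegative; strictness comes from
    \<open>m = 0\<close>.\<close>
  define w where "w m = (s * real m - z) * x ^ m * (u ^ m - u powr (z / s))" for m :: nat
  have nonneg: "w m \<ge> 0" for m
  proof (cases "s * real m \<ge> z")
    case True
    then have "z / s \<le> real m" using assms by (simp add: field_simps)
    then have "u powr (z / s) \<le> u ^ m" using u
      by (simp add: powr_realpow[symmetric] powr_mono)
    then show ?thesis using True assms by (simp add: w_def)
  next
    case False
    then have "real m \<le> z / s" using assms by (simp add: field_simps)
    then have "u ^ m \<le> u powr (z / s)" using u
      by (simp add: powr_realpow[symmetric] powr_mono)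
    then show ?thesis using False assms
      by (simp add: w_def mult_nonpos_nonpos mult_nonpos_nonneg)
  qed
  have "u powr (z / s) > 1" using u assms by simp
  then have "w 0 > 0" using assms by (simp add: w_def mult_pos_neg)
  then have "(\<Sum>m<k. w m) > 0"
    using nonneg assms by (intro sum_pos2[of _ 0]) auto
  also have "(\<Sum>m<k. w m)
      = (\<Sum>m<k. (s * real m - z) * y ^ m) - u powr (z / s) * (\<Sum>m<k. (s * real m - z) * x ^ m)"
    by (simp add: w_def y sum_distrib_left sum_subtractf[symmetric] algebra_simps power_mult_distrib)
  finally show ?thesis by (simp add: root)
qed

text \<open>The hypotheses give the second factor \<open>h\<close> opposite signs at the endpoints:
  \<open>h 0 = - z\<close>, and \<open>2 * h 1 = k * ((k - 1) * s - 2 * z)\<close> by the Gauss sum.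
  A root then exists by the intermediate value theorem, and positivity beyond any positive root
  excludes another one.\<close>

lemma ex1_root_score_polynomial:
  fixes s z :: real
  assumes "z > 0" and z2: "2 * z < (real k - 1) * s" and k: "k > 1"
  shows "\<exists>!y. y \<in> {0<..<1} \<and>
    (- s - z + real k * s) * y ^ (k + 1) - (- z + real k * s) * y ^ k + (z + s) * y - z = 0"
proof -
  define h where "h y = (\<Sum>m<k. (s * real m - z) * y ^ m)" for y :: real
  have "0 < (real k - 1) * s" using assms by linarith
  then have s: "s > 0" using k by (simp add: zero_less_mult_iff)
  obtain k' where k': "k = Suc k'" using k by (cases k) auto
  have "h 0 = - z"
    unfolding h_def k' by (simp add: sum.lessThan_Suc_shift del: sum.lessThan_Suc)
  then have h0: "h 0 < 0" using assms by simp
  have gauss: "2 * (\<Sum>m<k. real m) = real k * (real k - 1)"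
    by (induction k) (auto simp: algebra_simps)
  have "2 * h 1 = s * (2 * (\<Sum>m<k. real m)) - 2 * (real k * z)"
    by (simp add: h_def sum_subtractf sum_distrib_left mult_ac)
  also have "\<dots> = real k * ((real k - 1) * s - 2 * z)"
    unfolding gauss by (simp add: algebra_simps)
  also have "\<dots> > 0" using z2 k by simp
  finally have h1: "h 1 > 0" by simp
  have "\<exists>y\<ge>0. y \<le> 1 \<and> h y = 0"
    using h0 h1 by (intro IVT') (auto simp: h_def intro!: continuous_intros)
  then obtain y where y: "y \<ge> 0" "y \<le> 1" "h y = 0" by auto
  have "y \<noteq> 0" "y \<noteq> 1" using h0 h1 y by auto
  then have y01: "y \<in> {0<..<1}" using y by auto
  have beyond: "h v > 0" if "0 < u" "u < v" "h u = 0" for u v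
    using that linear_coeff_sum_pos_beyond_root[of s z k u v] s assms k by (simp add: h_def)
  have uniq: "v = y" if "v \<in> {0<..<1}" "h v = 0" for v
    using beyond[of v y] beyond[of y v] that y y01 by (cases v y rule: linorder_cases) auto
  have "\<exists>!y. y \<in> {0<..<1} \<and> h y = 0"
    using y y01 uniq by blast
  moreover have "(1 - y)\<^sup>2 * h y = 0 \<longleftrightarrow> h y = 0" if "y \<in> {0<..<1}" for y
    using that by simp
  ultimately show ?thesis
    unfolding score_polynomial_factor h_def[symmetric] by (metis (no_types, lifting))
qed

section \<open>Exponential moments of Poisson counts\<close>

text \<open>The probability generating function, read off from the exponential series at
  \<open>\<mu> * v\<close>. The case \<open>v = 0\<close> is used later: as
  \<open>0 ^ 0 = 1\<close>, it gives the probability of a zero count.\<close>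

lemma nn_integral_poisson_power:
  fixes v :: real
  assumes "\<mu> > 0" "v \<ge> 0"
  shows "(\<integral>\<^sup>+x. ennreal (v ^ x) \<partial>measure_pmf (poisson_pmf \<mu>)) = ennreal (exp (\<mu> * (v - 1)))"
proof -
  have "(\<lambda>x. (\<mu> * v) ^ x /\<^sub>R fact x * exp (- \<mu>)) sums (exp (\<mu> * v) * exp (- \<mu>))"
    by (intro sums_mult2 exp_converges)
  also have "(\<lambda>x. (\<mu> * v) ^ x /\<^sub>R fact x * exp (- \<mu>)) = (\<lambda>x. pmf (poisson_pmf \<mu>) x * v ^ x)"
    using assms by (auto simp: fun_eq_iff power_mult_distrib field_simps)
  also have "exp (\<mu> * v) * exp (- \<mu>) = exp (\<mu> * (v - 1))"
    by (simp add: exp_add[symmetric] algebra_simps)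
  finally have sums: "(\<lambda>x. pmf (poisson_pmf \<mu>) x * v ^ x) sums exp (\<mu> * (v - 1))" .
  have "(\<integral>\<^sup>+x. ennreal (v ^ x) \<partial>measure_pmf (poisson_pmf \<mu>))
      = (\<Sum>x. ennreal (pmf (poisson_pmf \<mu>) x * v ^ x))"
    using assms by (simp add: nn_integral_measure_pmf nn_integral_count_space_nat ennreal_mult'[symmetric])
  also have "\<dots> = ennreal (exp (\<mu> * (v - 1)))"
    using assms by (intro suminf_ennreal_eq sums) auto
  finally show ?thesis .
qed

text \<open>Markov's inequality for the weighted product and the first Borel--Cantelli lemma: the
  expectation of the product decays geometrically in \<open>n\<close>.\<close>

lemma (in prob_space) AE_eventually_poisson_product_less_1:
  fixes X :: "nat \<Rightarrow> nat \<Rightarrow> 'a \<Rightarrow> nat" and v \<mu> :: "nat \<Rightarrow> real"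
  assumes indep: "indep_vars (\<lambda>_. count_space UNIV) (\<lambda>(i, j). X i j) ({1..k} \<times> {1..})"
    and poisson: "\<And>i j. i \<in> {1..k} \<Longrightarrow> j \<ge> 1 \<Longrightarrow>
      distr M (count_space UNIV) (X i j) = measure_pmf (poisson_pmf (\<mu> i))"
    and \<mu>: "\<And>i. i \<in> {1..k} \<Longrightarrow> \<mu> i > 0"
    and v: "\<And>i. v i \<ge> 0"
    and decay: "(\<Sum>i=1..k. \<mu> i * (v i - 1)) < 0"
  shows "AE \<omega> in M. \<forall>\<^sub>F n in sequentially. (\<Prod>j=1..n. \<Prod>i=1..k. v i ^ X i j \<omega>) < 1"
proof -
  define Q where "Q n \<omega> = (\<Prod>j=1..n. \<Prod>i=1..k. v i ^ X i j \<omega>)" for n \<omega>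
  \<comment> \<open>\<open>\<rho>\<close> is the expected product over the layers of one experiment;
    by independence, \<open>n\<close> experiments give \<open>\<rho> ^ n\<close>.\<close>
  define \<rho> where "\<rho> = exp (\<Sum>i=1..k. \<mu> i * (v i - 1))"
  have \<rho>: "0 < \<rho>" "\<rho> < 1" using decay by (auto simp: \<rho>_def)
  have [measurable]: "X i j \<in> measurable M (count_space UNIV)" if "i \<in> {1..k}" "j \<in> {1..n}" for i j n
    using indep that unfolding indep_vars_def by auto
  have [measurable]: "Q n \<in> borel_measurable M" for n
    unfolding Q_def by measurable
  have Qnn: "Q n \<omega> \<ge> 0" for n \<omega> unfolding Q_def using v by (intro prod_nonneg) auto
  have int: "(\<integral>\<^sup>+\<omega>. ennreal (Q n \<omega>) \<partial>M) = ennreal (\<rho> ^ n)" for n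
  proof -
    let ?I = "{1..k} \<times> {1..n}"
    let ?Y = "\<lambda>ij \<omega>. ennreal (v (fst ij) ^ X (fst ij) (snd ij) \<omega>)"
    have "indep_vars (\<lambda>_. count_space UNIV) (\<lambda>(i, j). X i j) ?I"
      by (rule indep_vars_subset[OF indep]) auto
    then have "indep_vars (\<lambda>_. borel)
        (\<lambda>ij \<omega>. ennreal (v (fst ij) ^ (case ij of (i, j) \<Rightarrow> X i j) \<omega>)) ?I"
      by (rule indep_vars_compose2[where Y = "\<lambda>ij x. ennreal (v (fst ij) ^ x)"]) auto
    then have ind: "indep_vars (\<lambda>_. borel) ?Y ?I"
      by (simp add: case_prod_unfold)
    have "ennreal (Q n \<omega>) = (\<Prod>ij\<in>?I. ?Y ij \<omega>)" for \<omega>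
      unfolding Q_def using v
      by (subst prod.swap) (simp add: prod.cartesian_product prod_ennreal case_prod_unfold)
    then have "(\<integral>\<^sup>+\<omega>. ennreal (Q n \<omega>) \<partial>M) = (\<integral>\<^sup>+\<omega>. (\<Prod>ij\<in>?I. ?Y ij \<omega>) \<partial>M)"
      by simp
    also have "\<dots> = (\<Prod>ij\<in>?I. \<integral>\<^sup>+\<omega>. ?Y ij \<omega> \<partial>M)"
      by (rule indep_vars_nn_integral[OF _ ind]) auto
    also have "\<dots> = (\<Prod>ij\<in>?I. ennreal (exp (\<mu> (fst ij) * (v (fst ij) - 1))))"
    proof (rule prod.cong[OF refl])
      fix ij assume "ij \<in> ?I"
      then obtain i j where ij: "ij = (i, j)" "i \<in> {1..k}" "j \<in> {1..n}" by auto
      have "(\<integral>\<^sup>+\<omega>. ennreal (v i ^ X i j \<omega>) \<partial>M)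
          = (\<integral>\<^sup>+x. ennreal (v i ^ x) \<partial>distr M (count_space UNIV) (X i j))"
        using ij by (subst nn_integral_distr) auto
      also have "\<dots> = ennreal (exp (\<mu> i * (v i - 1)))"
        using ij \<mu> v by (simp add: poisson nn_integral_poisson_power)
      finally show "(\<integral>\<^sup>+\<omega>. ?Y ij \<omega> \<partial>M) = ennreal (exp (\<mu> (fst ij) * (v (fst ij) - 1)))"
        by (simp add: ij)
    qed
    also have "\<dots> = ennreal (\<Prod>i=1..k. \<Prod>j=1..n. exp (\<mu> i * (v i - 1)))"
      unfolding prod.cartesian_product by (simp add: prod_ennreal case_prod_unfold)
    also have "(\<Prod>i=1..k. \<Prod>j=1..n. exp (\<mu> i * (v i - 1))) = \<rho> ^ n"
      by (simp add: \<rho>_def exp_sum prod_power_distrib)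
    finally show ?thesis .
  qed
  define A where "A n = {\<omega> \<in> space M. Q n \<omega> \<ge> 1}" for n
  have A: "A n \<in> sets M" for n unfolding A_def by measurable
  have bound: "measure M (A n) \<le> \<rho> ^ n" for n
  proof -
    have "emeasure M (A n) = (\<integral>\<^sup>+\<omega>. indicator (A n) \<omega> \<partial>M)" using A by simp
    also have "\<dots> \<le> (\<integral>\<^sup>+\<omega>. ennreal (Q n \<omega>) \<partial>M)"
      by (intro nn_integral_mono) (auto simp: A_def indicator_def)
    finally show ?thesis using \<rho> by (simp add: int emeasure_eq_measure)
  qed
  have "summable (\<lambda>n. measure M (A n))"
    by (rule summable_comparison_test'[OF summable_geometric[of \<rho>], of 0])
       (use \<rho> bound in auto)
  then have "AE \<omega> in M. \<forall>\<^sub>F n in sequentially. \<omega> \<in> space M - A n"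
    using A by (intro borel_cantelli_AE1) (auto simp: emeasure_eq_measure)
  then show ?thesis
    by (rule AE_mp) (auto simp: A_def Q_def not_le elim: eventually_mono)
qed

section \<open>Application to the detector rates\<close>

text \<open>Arithmetic-geometric mean inequality for the exponents \<open>m\<close> and
  \<open>k - 1 - m\<close>: the squares \<open>w m\<close> sum to twice the difference of the two
  sides, and \<open>w 0\<close> is positive. This supplies the decay condition for the tilted
  product.\<close>

lemma card_mult_middle_power_less_geometric_sum:
  fixes r :: real
  assumes "0 < r" "r < 1" "k > 1"
  shows "real k * r ^ (k - 1) < (\<Sum>m<k. (r\<^sup>2) ^ m)"
proof -
  define w where "w m = (r ^ m - r ^ (k - 1 - m))\<^sup>2" for m
  have w: "w m = (r\<^sup>2) ^ m + (r\<^sup>2) ^ (k - Suc m) - 2 * r ^ (k - 1)" if "m < k" for m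
  proof -
    have "r ^ m * r ^ (k - 1 - m) = r ^ (k - 1)"
      using that by (simp add: power_add[symmetric])
    then show ?thesis
      by (simp add: w_def power2_diff power_mult[symmetric] mult.commute)
  qed
  have "r ^ (k - 1) < 1" using assms by (simp add: power_less_one_iff)
  then have "w 0 > 0" by (simp add: w_def)
  then have "0 < (\<Sum>m<k. w m)"
    using assms by (intro sum_pos2[of _ 0]) (auto simp: w_def)
  also have "\<dots> = (\<Sum>m<k. (r\<^sup>2) ^ m) + (\<Sum>m<k. (r\<^sup>2) ^ (k - Suc m)) - 2 * (real k * r ^ (k - 1))"
    using w by (simp add: sum_subtractf sum.distrib)
  also have "(\<Sum>m<k. (r\<^sup>2) ^ (k - Suc m)) = (\<Sum>m<k. (r\<^sup>2) ^ m)"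
    by (rule sum.nat_diff_reindex)
  finally show ?thesis by simp
qed

(* The conclusion fails for degenerate parameters: if p * lam * t = 0, then almost surely all
   counts are zero and the equation reads 0 = 0; if p = 1, then almost surely z_n = 0, and the
   polynomial s_n * y * ((k - 1) * y ^ k - k * y ^ (k - 1) + 1) has either no root in (0, 1) or
   infinitely many. Hence the assumptions nondeg_p, nondeg_lam and t. *)
theorem lemma3:
  fixes M :: "'a measure"
    and X :: "nat \<Rightarrow> nat \<Rightarrow> 'a \<Rightarrow> nat"
    and k :: nat
    and p lam t :: real
  assumes prob_space: "prob_space M"
    and k: "k > 1"
    and t: "t > 0"
    and p: "p \<in> {0..1}"
    and lam: "lam \<in> {0..}"
    and nondeg_p: "p * (1 - p) \<noteq> 0"
    and nondeg_lam: "lam \<noteq> 0"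
    and indep: "prob_space.indep_vars M (\<lambda>_. count_space UNIV) (\<lambda>(i, j). X i j) ({1..k} \<times> {1..})"
    and poisson: "\<And>i j. i \<in> {1..k} \<Longrightarrow> j \<ge> 1 \<Longrightarrow>
      distr M (count_space UNIV) (X i j)
        = measure_pmf (poisson_pmf (p * (1 - p) ^ (i - 1) * lam * t))"
  shows "AE \<omega> in M. \<forall>\<^sub>F n in sequentially. \<omega> \<in> unique_root_event M X k n"
proof -
  interpret prob_space M by (rule prob_space)
  \<comment> \<open>The exponents \<open>e i\<close> below go down in steps of 2, so a square root
    of \<open>1 - p\<close> is needed to cancel \<open>(1 - p) ^ (i - 1)\<close>.\<close>
  define r where "r = sqrt (1 - p)"
  define \<mu> where "\<mu> i = p * (1 - p) ^ (i - 1) * lam * t" for i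
  have p01: "0 < p" "p < 1" using p nondeg_p by (auto simp: less_le)
  have rate: "p * lam * t > 0" using p01 lam nondeg_lam t by simp
  have r: "0 < r" "r < 1" and r2: "r\<^sup>2 = 1 - p" using p01 by (auto simp: r_def)
  have \<mu>: "\<mu> i > 0" for i using p01 lam nondeg_lam t by (simp add: \<mu>_def)
  note product = AE_eventually_poisson_product_less_1[OF indep poisson[folded \<mu>_def] \<mu>]

  have z_pos: "AE \<omega> in M. \<forall>\<^sub>F n in sequentially. 0 < z_stat X k n \<omega>"
  proof -
    \<comment> \<open>With these weights the product is the indicator that layer 2, the first with
      nonzero weight in \<open>z_stat\<close>, has detected nothing in \<open>n\<close>
      experiments.\<close>
    define v :: "nat \<Rightarrow> real" where "v i = (if i = 2 then 0 else 1)" for i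
    have "(\<Sum>i=1..k. \<mu> i * (v i - 1)) = (\<Sum>i=1..k. if i = 2 then - \<mu> i else 0)"
      by (intro sum.cong) (auto simp: v_def)
    also have "\<dots> < 0" using k \<mu> by simp
    finally have less1: "AE \<omega> in M. \<forall>\<^sub>F n in sequentially. (\<Prod>j=1..n. \<Prod>i=1..k. v i ^ X i j \<omega>) < 1"
      by (intro product) (simp_all add: v_def)
    have pos: "0 < z_stat X k n \<omega>" if "(\<Prod>j=1..n. \<Prod>i=1..k. v i ^ X i j \<omega>) < 1" for n \<omega>
    proof -
      have "\<exists>j\<in>{1..n}. X 2 j \<omega> > 0"
      proof (rule ccontr)
        assume *: "\<not> ?thesis"
        have "(\<Prod>j=1..n. \<Prod>i=1..k. v i ^ X i j \<omega>) = 1"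
          using * by (intro prod.neutral ballI) (auto simp: v_def)
        then show False using that by simp
      qed
      then obtain j where j: "j \<in> {1..n}" "X 2 j \<omega> > 0" by auto
      have layers: "0 < (\<Sum>i=1..k. (real i - 1) * real (X i j \<omega>))"
        using j k by (intro sum_pos2[of _ 2]) auto
      have "0 < (\<Sum>j=1..n. \<Sum>i=1..k. (real i - 1) * real (X i j \<omega>))"
        by (rule sum_pos2[of _ j]) (use j layers in \<open>auto intro!: sum_nonneg\<close>)
      then show ?thesis using j by (simp add: z_stat_def)
    qed
    show ?thesis
      using less1
    proof eventually_elim
      case (elim \<omega>)
      then show ?case by (rule eventually_mono) (rule pos)
    qed
  qed

  have z_less: "AE \<omega> in M. \<forall>\<^sub>F n in sequentially.
      2 * z_stat X k n \<omega> < (real k - 1) * s_stat X k n \<omega>"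
  proof -
    \<comment> \<open>this tilting makes \<open>\<mu> i * v i\<close> independent of \<open>i\<close>\<close>
    define e where "e i = real k - 1 - 2 * (real i - 1)" for i
    define v where "v i = r powr e i" for i
    have tilt: "\<mu> i * v i = p * lam * t * r ^ (k - 1)" if "i \<in> {1..k}" for i
    proof -
      have "(1 - p) ^ (i - 1) = r ^ (2 * (i - 1))"
        unfolding r2[symmetric] power_mult ..
      also have "\<dots> = r powr real (2 * (i - 1))"
        by (rule powr_realpow[OF r(1), symmetric])
      also have "real (2 * (i - 1)) = 2 * (real i - 1)"
        using that by (simp add: of_nat_diff)
      finally have "\<mu> i * v i = p * lam * t * (r powr (2 * (real i - 1)) * r powr e i)"
        by (simp add: \<mu>_def v_def)
      also have "r powr (2 * (real i - 1)) * r powr e i = r powr (real k - 1)"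
        unfolding powr_add[symmetric] by (simp add: e_def)
      also have "r powr (real k - 1) = r ^ (k - 1)"
        using powr_realpow[OF r(1), of "k - 1"] k by (simp add: of_nat_diff)
      finally show ?thesis .
    qed
    \<comment> \<open>The tilted rates are all equal, while the original rates form a geometric
      series in \<open>r\<^sup>2\<close>.\<close>
    have "(\<Sum>i=1..k. \<mu> i * (v i - 1)) = (\<Sum>i=1..k. p * lam * t * r ^ (k - 1) - \<mu> i)"
      by (intro sum.cong) (auto simp: right_diff_distrib tilt)
    also have "\<dots> = p * lam * t * (real k * r ^ (k - 1)) - (\<Sum>i=1..k. \<mu> i)"
      by (simp add: sum_subtractf)
    also have "(\<Sum>i=1..k. \<mu> i) = (\<Sum>m<k. \<mu> (Suc m))"
      by (rule sum.reindex_bij_witness[of _ Suc "\<lambda>i. i - 1"]) auto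
    also have "\<dots> = p * lam * t * (\<Sum>m<k. (r\<^sup>2) ^ m)"
      by (simp add: \<mu>_def r2 sum_distrib_left mult_ac)
    also have "p * lam * t * (real k * r ^ (k - 1)) - p * lam * t * (\<Sum>m<k. (r\<^sup>2) ^ m)
        = p * lam * t * (real k * r ^ (k - 1) - (\<Sum>m<k. (r\<^sup>2) ^ m))"
      by (simp only: right_diff_distrib)
    also have "\<dots> < 0"
      using card_mult_middle_power_less_geometric_sum[OF r k] by (intro mult_pos_neg rate) simp
    finally have less1: "AE \<omega> in M. \<forall>\<^sub>F n in sequentially. (\<Prod>j=1..n. \<Prod>i=1..k. v i ^ X i j \<omega>) < 1"
      by (intro product) (simp_all add: v_def)
    have less: "2 * z_stat X k n \<omega> < (real k - 1) * s_stat X k n \<omega>"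
      if lt1: "(\<Prod>j=1..n. \<Prod>i=1..k. v i ^ X i j \<omega>) < 1" for n \<omega>
    proof -
      \<comment> \<open>\<open>e i\<close> is the coefficient of a layer \<open>i\<close> count in
        \<open>n * ((k - 1) * s - 2 * z)\<close>. The product is \<open>r powr W\<close> with
        \<open>r < 1\<close>, so it is below 1 only if \<open>W > 0\<close>.\<close>
      define W where "W = (\<Sum>j=1..n. \<Sum>i=1..k. e i * real (X i j \<omega>))"
      \<comment> \<open>For \<open>n = 0\<close> the product is empty and equals 1.\<close>
      have n: "n > 0" using lt1 by (cases n) auto
      have "(\<Prod>j=1..n. \<Prod>i=1..k. v i ^ X i j \<omega>) = r powr W"
        using r by (simp add: W_def v_def powr_sum powr_power mult.commute)
      then have "r powr W < r powr 0" using lt1 r by simp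
      then have "W > 0" using r powr_mono'[of W 0 r] by linarith
      also have "W = real n * ((real k - 1) * s_stat X k n \<omega> - 2 * z_stat X k n \<omega>)"
      proof -
        have e_mult: "e i * x = (real k - 1) * x - 2 * ((real i - 1) * x)" for i x
          by (simp add: e_def algebra_simps)
        have "W = (\<Sum>j=1..n. (real k - 1) * (\<Sum>i=1..k. real (X i j \<omega>))
            - 2 * (\<Sum>i=1..k. (real i - 1) * real (X i j \<omega>)))"
          by (simp add: W_def e_mult sum_distrib_left sum_subtractf)
        also have "\<dots> = real n * ((real k - 1) * s_stat X k n \<omega> - 2 * z_stat X k n \<omega>)"
          using n by (simp add: s_stat_def z_stat_def sum_subtractf sum_distrib_left[symmetric]
            right_diff_distrib)
        finally show ?thesis .
      qed
      finally show ?thesis using n by (simp add: zero_less_mult_iff)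
    qed
    show ?thesis
      using less1
    proof eventually_elim
      case (elim \<omega>)
      then show ?case by (rule eventually_mono) (rule less)
    qed
  qed

  have in_event: "\<omega> \<in> unique_root_event M X k n"
    if "\<omega> \<in> space M" "0 < z_stat X k n \<omega>" "2 * z_stat X k n \<omega> < (real k - 1) * s_stat X k n \<omega>" for n \<omega>
    unfolding unique_root_event_def a_coef_def b_coef_def c_coef_def d_coef_def mem_Collect_eq
    using that(1) ex1_root_score_polynomial[OF that(2,3) k] by (rule conjI)
  show ?thesis
    using z_pos z_less AE_space
  proof eventually_elim
    case (elim \<omega>)
    show ?case using elim(1,2) by eventually_elim (rule in_event[OF elim(3)])
  qed
qed

end
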